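(* Let $\mu:\mathbb{R}\to\mathbb{R}$, $\sigma:\mathbb{R}\to\mathbb{R}_+$, $r:\mathbb{R}\to\mathbb{R}$, $g:\mathbb{R}\to\mathbb{R}$ be continuous. For any $m>m_0$ fixed, with $\Delta t=2^{-2m}$, $\Delta x=2^{-m}$, $t_k=k\Delta t$, the discrete Feynman--Kac functional $$f_m(t_k,x):=\mathbb{E}^x\left\{\exp\left(-\sum_{i=0}^{k-1}r(S_m(t_i))\Delta t\right)g(S_m(t_k))\right\}\qquad(t_k\ge0,\ x\in\mathbb{R})$$ is the unique solution of the difference equation (a discrete Feynman--Kac formula) $$\frac{f_m(t_{k+1},x)-f_m(t_k,x)}{\Delta t}=\frac12e^{-r(x)\Delta t}\,\frac{f_m(t_k,x^+)+f_m(t_k,x^-)-2f_m(t_k,x)}{(\Delta x)^2}+\frac{e^{-r(x)\Delta t}-1}{\Delta t}f_m(t_k,x),$$ with the initial condition $f_m(0,x)=g(x)$, where $x^\pm:=x+\mu(x)\Delta t\pm\sigma(x)\Delta x$.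
   Context: $m$ is a nonnegative integer. $S_m$ is the discrete time-homogeneous It\^o process $S_m(t_{k+1})-S_m(t_k)=\mu(S_m(t_k))\Delta t+\sigma(S_m(t_k))\Delta B_m(t_{k+1})$, where the $\Delta B_m(t_{k+1})$, $k\ge0$, are independent and equal $\pm\Delta x$ with probability $\frac12$ each (steps of a shrunken simple symmetric random walk $B_m$). $\mathbb{E}^x$ is the expectation when the process starts from $S_m(t_0)=x$. The threshold $m_0$ is the one the paper fixes for its constant-coefficient linear financial model with drift constant $\bar\mu\in\mathbb{R}$, volatility $\bar\sigma>0$ and interest rate $\bar r>0$: $m_0=\frac{1}{\log2}\log\frac{|\bar r-\bar\mu|}{\bar\sigma}$; here it enters only as a lower bound on $m$. *)

theory Defs
  imports "HOL-Probability.Probability"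
begin

definition dt :: "nat \<Rightarrow> real" where
  "dt m = 1 / 2 ^ (2 * m)"

definition dx :: "nat \<Rightarrow> real" where
  "dx m = 1 / 2 ^ m"

text \<open>
  Throughout, functions of a grid time \<open>t\<^sub>k = k \<Delta>t\<close> are represented as functions
  of the index \<open>k\<close>; as \<open>\<Delta>t > 0\<close>, the two determine each other.
  The increment \<open>\<Delta>B\<^sub>m(t\<^sub>k)\<close> is \<open>dB k\<close>, for \<open>k \<ge> 1\<close>; \<open>dB 0\<close> is never used.
\<close>

definition walk_steps :: "'a measure \<Rightarrow> nat \<Rightarrow> (nat \<Rightarrow> 'a \<Rightarrow> real) \<Rightarrow> bool" where
  "walk_steps M m dB \<longleftrightarrow>
     prob_space M \<and>
     prob_space.indep_vars M (\<lambda>_. borel) dB {1..} \<and>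
     (\<forall>k\<ge>1. measure M {\<omega> \<in> space M. dB k \<omega> = dx m} = 1 / 2 \<and>
             measure M {\<omega> \<in> space M. dB k \<omega> = - dx m} = 1 / 2)"

primrec Ito_process ::
  "nat \<Rightarrow> (real \<Rightarrow> real) \<Rightarrow> (real \<Rightarrow> real) \<Rightarrow> (nat \<Rightarrow> 'a \<Rightarrow> real) \<Rightarrow> real \<Rightarrow> nat \<Rightarrow> 'a \<Rightarrow> real" where
  "Ito_process m \<mu> \<sigma> dB x 0 \<omega> = x"
| "Ito_process m \<mu> \<sigma> dB x (Suc k) \<omega> =
     Ito_process m \<mu> \<sigma> dB x k \<omega>
       + \<mu> (Ito_process m \<mu> \<sigma> dB x k \<omega>) * dt m
       + \<sigma> (Ito_process m \<mu> \<sigma> dB x k \<omega>) * dB (Suc k) \<omega>"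

definition feynman_kac ::
  "'a measure \<Rightarrow> nat \<Rightarrow> (nat \<Rightarrow> 'a \<Rightarrow> real) \<Rightarrow> (real \<Rightarrow> real) \<Rightarrow> (real \<Rightarrow> real) \<Rightarrow>
   (real \<Rightarrow> real) \<Rightarrow> (real \<Rightarrow> real) \<Rightarrow> nat \<Rightarrow> real \<Rightarrow> real" where
  "feynman_kac M m dB \<mu> \<sigma> r g k x =
     prob_space.expectation M (\<lambda>\<omega>.
       exp (- (\<Sum>i<k. r (Ito_process m \<mu> \<sigma> dB x i \<omega>) * dt m))
         * g (Ito_process m \<mu> \<sigma> dB x k \<omega>))"

definition x_plus :: "nat \<Rightarrow> (real \<Rightarrow> real) \<Rightarrow> (real \<Rightarrow> real) \<Rightarrow> real \<Rightarrow> real" where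
  "x_plus m \<mu> \<sigma> x = x + \<mu> x * dt m + \<sigma> x * dx m"

definition x_minus :: "nat \<Rightarrow> (real \<Rightarrow> real) \<Rightarrow> (real \<Rightarrow> real) \<Rightarrow> real \<Rightarrow> real" where
  "x_minus m \<mu> \<sigma> x = x + \<mu> x * dt m - \<sigma> x * dx m"

definition solves_difference_equation ::
  "nat \<Rightarrow> (real \<Rightarrow> real) \<Rightarrow> (real \<Rightarrow> real) \<Rightarrow> (real \<Rightarrow> real) \<Rightarrow> (real \<Rightarrow> real) \<Rightarrow>
   (nat \<Rightarrow> real \<Rightarrow> real) \<Rightarrow> bool" where
  "solves_difference_equation m \<mu> \<sigma> r g f \<longleftrightarrow>
     (\<forall>x. f 0 x = g x) \<and>
     (\<forall>k x. (f (Suc k) x - f k x) / dt m =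
        1 / 2 * exp (- r x * dt m) *
          ((f k (x_plus m \<mu> \<sigma> x) + f k (x_minus m \<mu> \<sigma> x) - 2 * f k x) / (dx m)\<^sup>2)
        + (exp (- r x * dt m) - 1) / dt m * f k x)"

text \<open>
  The case \<open>r = \<mu>\<close> uses \<open>log 0 = -\<infinity>\<close>, i.e. there is no restriction on \<open>m\<close>;
  the real-valued \<open>ln 0 = 0\<close> would instead exclude \<open>m = 0\<close>.
\<close>

definition m_threshold :: "real \<Rightarrow> real \<Rightarrow> real \<Rightarrow> ereal" where
  "m_threshold \<mu> \<sigma> r =
     (if r = \<mu> then -\<infinity> else ereal (1 / ln 2 * ln (\<bar>r - \<mu>\<bar> / \<sigma>)))"

end

theory Submission
  imports Defs
begin

text \<open>
  Since \<open>(\<Delta>x)\<^sup>2 = \<Delta>t\<close>, the difference equation is the recursion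
  \<open>f\<^sub>k\<^sub>+\<^sub>1 = T f\<^sub>k\<close> with \<open>T h x = e\<^bsup>-r(x)\<Delta>t\<^esup> (h(x\<^sup>+) + h(x\<^sup>-)) / 2\<close>, whose only solution
  is \<open>f\<^sub>k = T\<^sup>k g\<close>.  Conditioning on the \<^emph>\<open>last\<close> step of the walk shows that the functional
  with payoff \<open>h\<close> at time \<open>k + 1\<close> equals the one with payoff \<open>T h\<close> at time \<open>k\<close>;
  iterating gives \<open>T\<^sup>k g\<close>.  Compared with conditioning on the first step, this avoids the
  Markov property of the restarted process.
\<close>

section \<open>The one-step operator and the difference equation\<close>

definition fk_step ::
  "nat \<Rightarrow> (real \<Rightarrow> real) \<Rightarrow> (real \<Rightarrow> real) \<Rightarrow> (real \<Rightarrow> real) \<Rightarrow> (real \<Rightarrow> real) \<Rightarrow> real \<Rightarrow> real" where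
  "fk_step m \<mu> \<sigma> r h x =
     exp (- r x * dt m) * (h (x_plus m \<mu> \<sigma> x) + h (x_minus m \<mu> \<sigma> x)) / 2"

text \<open>The noise is an argument, as in \<open>Ito_process\<close>, so that the coordinate maps
  \<open>\<lambda>i y. y i\<close> on vectors of steps can be inserted for \<open>dB\<close>; this
  exhibits both as functions of the steps alone.\<close>

definition discount ::
  "nat \<Rightarrow> (real \<Rightarrow> real) \<Rightarrow> (real \<Rightarrow> real) \<Rightarrow> (real \<Rightarrow> real) \<Rightarrow> (nat \<Rightarrow> 'a \<Rightarrow> real) \<Rightarrow> real \<Rightarrow> nat \<Rightarrow> 'a \<Rightarrow> real" where
  "discount m \<mu> \<sigma> r dB x k \<omega> = exp (- (\<Sum>i<k. r (Ito_process m \<mu> \<sigma> dB x i \<omega>) * dt m))"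

lemma dt_pos: "dt m > 0"
  by (simp add: dt_def)

lemma dx_pos: "dx m > 0"
  by (simp add: dx_def)

lemma dx_squared: "(dx m)\<^sup>2 = dt m"
  by (simp add: dx_def dt_def power_divide power_mult mult.commute[of 2])

lemma discount_0: "discount m \<mu> \<sigma> r dB x 0 \<omega> = 1"
  by (simp add: discount_def)

lemma discount_Suc:
  "discount m \<mu> \<sigma> r dB x (Suc k) \<omega> =
     discount m \<mu> \<sigma> r dB x k \<omega> * exp (- r (Ito_process m \<mu> \<sigma> dB x k \<omega>) * dt m)"
  by (simp add: discount_def flip: exp_add)

text \<open>The scheme is explicit in time: each layer is determined by the one before. The
  equivalence therefore yields existence and uniqueness at once.\<close>

lemma solves_difference_equation_iff:
  "solves_difference_equation m \<mu> \<sigma> r g f \<longleftrightarrow> f = (\<lambda>k. (fk_step m \<mu> \<sigma> r ^^ k) g)"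
proof -
  have "(a - b) / d = 1 / 2 * e * ((p + q - 2 * b) / d) + (e - 1) / d * b \<longleftrightarrow> a = e * (p + q) / 2"
    if "d > 0" for a b d e p q :: real
  proof -
    \<comment> \<open>With \<open>d\<close> for both \<open>dt m\<close> and
      \<open>(dx m)^2\<close>, the term \<open>- e * b\<close> of the second difference cancels
      \<open>e * b\<close> of the discount term.\<close>
    have "1 / 2 * e * ((p + q - 2 * b) / d) + (e - 1) / d * b = (e * (p + q) / 2 - b) / d"
      using that by (simp add: field_simps)
    then show ?thesis
      using that by simp
  qed
  then have "solves_difference_equation m \<mu> \<sigma> r g f \<longleftrightarrow>
      f 0 = g \<and> (\<forall>k. f (Suc k) = fk_step m \<mu> \<sigma> r (f k))"
    using dt_pos[of m]
    by (simp add: solves_difference_equation_def dx_squared fk_step_def fun_eq_iff)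
  also have "\<dots> \<longleftrightarrow> (\<forall>k. f k = (fk_step m \<mu> \<sigma> r ^^ k) g)"
  proof
    assume "f 0 = g \<and> (\<forall>k. f (Suc k) = fk_step m \<mu> \<sigma> r (f k))"
    then have "f k = (fk_step m \<mu> \<sigma> r ^^ k) g" for k
      by (induction k) auto
    then show "\<forall>k. f k = (fk_step m \<mu> \<sigma> r ^^ k) g" ..
  qed auto
  also have "\<dots> \<longleftrightarrow> f = (\<lambda>k. (fk_step m \<mu> \<sigma> r ^^ k) g)"
    by (simp add: fun_eq_iff)
  finally show ?thesis .
qed

section \<open>Path functionals as measurable functions of the first steps\<close>

lemma Ito_process_restrict:
  "k \<le> n \<Longrightarrow> Ito_process m \<mu> \<sigma> (\<lambda>i y. y i) x k (restrict (\<lambda>i. dB i \<omega>) {1..n}) =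
     Ito_process m \<mu> \<sigma> dB x k \<omega>"
  by (induction k) auto

lemma discount_restrict:
  "k \<le> n \<Longrightarrow> discount m \<mu> \<sigma> r (\<lambda>i y. y i) x k (restrict (\<lambda>i. dB i \<omega>) {1..n}) =
     discount m \<mu> \<sigma> r dB x k \<omega>"
  by (simp add: discount_def Ito_process_restrict del: One_nat_def)

text \<open>\<open>N\<close> is arbitrary because the lemma serves both \<open>M\<close> and the
  product space of step vectors. Only steps 1 to \<open>k\<close> are constrained: these are the
  coordinates of that product, and nothing is known about \<open>dB 0\<close> on
  \<open>M\<close>.\<close>

lemma measurable_Ito_process:
  assumes [measurable]: "\<mu> \<in> borel_measurable borel" "\<sigma> \<in> borel_measurable borel"
    and dB: "\<And>i. 1 \<le> i \<Longrightarrow> i \<le> k \<Longrightarrow> dB i \<in> borel_measurable N"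
  shows "Ito_process m \<mu> \<sigma> dB x k \<in> borel_measurable N"
  using dB
proof (induction k)
  case 0
  have "Ito_process m \<mu> \<sigma> dB x 0 = (\<lambda>\<omega>. x)"
    by (simp add: fun_eq_iff)
  then show ?case
    by simp
next
  case (Suc k)
  then have [measurable]: "Ito_process m \<mu> \<sigma> dB x k \<in> borel_measurable N"
    "dB (Suc k) \<in> borel_measurable N"
    by auto
  have "Ito_process m \<mu> \<sigma> dB x (Suc k) = (\<lambda>\<omega>. Ito_process m \<mu> \<sigma> dB x k \<omega> +
      \<mu> (Ito_process m \<mu> \<sigma> dB x k \<omega>) * dt m + \<sigma> (Ito_process m \<mu> \<sigma> dB x k \<omega>) * dB (Suc k) \<omega>)"
    by (simp add: fun_eq_iff)
  also have "\<dots> \<in> borel_measurable N"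
    by measurable
  finally show ?case .
qed

lemma measurable_discount:
  assumes [measurable]: "\<mu> \<in> borel_measurable borel" "\<sigma> \<in> borel_measurable borel"
      "r \<in> borel_measurable borel"
    and dB: "\<And>i. 1 \<le> i \<Longrightarrow> i \<le> k \<Longrightarrow> dB i \<in> borel_measurable N"
  shows "discount m \<mu> \<sigma> r dB x k \<in> borel_measurable N"
proof -
  have [measurable]: "Ito_process m \<mu> \<sigma> dB x i \<in> borel_measurable N" if "i < k" for i
    using that by (intro measurable_Ito_process dB) auto
  have "(\<lambda>\<omega>. \<Sum>i<k. r (Ito_process m \<mu> \<sigma> dB x i \<omega>) * dt m) \<in> borel_measurable N"
    by (intro borel_measurable_sum) simp
  then show ?thesis
    unfolding discount_def[abs_def] by measurable
qed

lemma measurable_fk_step: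
  assumes [measurable]: "\<mu> \<in> borel_measurable borel" "\<sigma> \<in> borel_measurable borel"
    "r \<in> borel_measurable borel" "h \<in> borel_measurable borel"
  shows "fk_step m \<mu> \<sigma> r h \<in> borel_measurable borel"
  unfolding fk_step_def[abs_def] x_plus_def x_minus_def by measurable

section \<open>Values of the walk steps\<close>

locale random_walk = prob_space M for M :: "'a measure" +
  fixes m :: nat and dB :: "nat \<Rightarrow> 'a \<Rightarrow> real"
  assumes walk_steps: "walk_steps M m dB"
begin

lemma indep: "indep_vars (\<lambda>_. borel) dB {1..}"
  using walk_steps by (simp add: walk_steps_def)

lemma measurable_dB: "1 \<le> i \<Longrightarrow> dB i \<in> borel_measurable M"
  using indep by (simp add: indep_vars_def)

lemma prob_dB:
  assumes "1 \<le> i" "s \<in> {dx m, - dx m}"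
  shows "prob {\<omega> \<in> space M. dB i \<omega> = s} = 1 / 2"
  using walk_steps assms by (auto simp: walk_steps_def)

lemma AE_dB:
  assumes i: "1 \<le> i"
  shows "AE \<omega> in M. dB i \<omega> = dx m \<or> dB i \<omega> = - dx m"
proof -
  have [measurable]: "dB i \<in> borel_measurable M"
    using measurable_dB[OF i] .
  have "prob ({\<omega> \<in> space M. dB i \<omega> = dx m} \<union> {\<omega> \<in> space M. dB i \<omega> = - dx m}) = 1 / 2 + 1 / 2"
    using dx_pos[of m] prob_dB[OF i, of "dx m"] prob_dB[OF i, of "- dx m"]
    by (subst finite_measure_Union) auto
  also have "{\<omega> \<in> space M. dB i \<omega> = dx m} \<union> {\<omega> \<in> space M. dB i \<omega> = - dx m} =
      {\<omega> \<in> space M. dB i \<omega> = dx m \<or> dB i \<omega> = - dx m}"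
    by auto
  finally show ?thesis
    using prob_Collect_eq_1[of "\<lambda>\<omega>. dB i \<omega> = dx m \<or> dB i \<omega> = - dx m"] by simp
qed

text \<open>Almost surely each step has only two values, so \<open>k\<close> steps leave finitely
  many outcomes. This replaces growth bounds on the coefficients and on the payoff.\<close>

lemma AE_finite_range:
  "\<exists>A. finite A \<and>
    (AE \<omega> in M. (discount m \<mu> \<sigma> r dB x k \<omega>, Ito_process m \<mu> \<sigma> dB x k \<omega>) \<in> A)"
proof (induction k)
  case 0
  then show ?case
    by (intro exI[of _ "{(1, x)}"]) (simp add: discount_0)
next
  case (Suc k)
  then obtain A where A: "finite A"
    "AE \<omega> in M. (discount m \<mu> \<sigma> r dB x k \<omega>, Ito_process m \<mu> \<sigma> dB x k \<omega>) \<in> A"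
    by blast
  \<comment> \<open>Update of discount \<open>d\<close> and state \<open>y\<close> by an increment
    \<open>s\<close>; the new range lies in the image of a finite product.\<close>
  define step where "step = (\<lambda>(s, d, y). (d * exp (- r y * dt m), y + \<mu> y * dt m + \<sigma> y * s))"
  have "AE \<omega> in M. (discount m \<mu> \<sigma> r dB x (Suc k) \<omega>, Ito_process m \<mu> \<sigma> dB x (Suc k) \<omega>)
      \<in> step ` ({dx m, - dx m} \<times> A)"
    using A(2) AE_dB[of "Suc k", simplified]
  proof eventually_elim
    case (elim \<omega>)
    then show ?case
      by (intro image_eqI[of _ _
            "(dB (Suc k) \<omega>, discount m \<mu> \<sigma> r dB x k \<omega>, Ito_process m \<mu> \<sigma> dB x k \<omega>)"])
        (auto simp: step_def discount_Suc)
  qed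
  with A(1) show ?case
    by (intro exI conjI) (simp_all only: finite_imageI finite_cartesian_product finite.intros)
qed

section \<open>Integrability and conditioning on the last step\<close>

context
  fixes \<mu> \<sigma> r :: "real \<Rightarrow> real"
  assumes meas[measurable]: "\<mu> \<in> borel_measurable borel" "\<sigma> \<in> borel_measurable borel"
    "r \<in> borel_measurable borel"
begin

lemma integrable_discounted:
  assumes [measurable]: "h \<in> borel_measurable borel"
  shows "integrable M (\<lambda>\<omega>. discount m \<mu> \<sigma> r dB x k \<omega> * h (Ito_process m \<mu> \<sigma> dB x k \<omega>))"
proof -
  have [measurable]: "Ito_process m \<mu> \<sigma> dB x k \<in> borel_measurable M"
    "discount m \<mu> \<sigma> r dB x k \<in> borel_measurable M"
    using measurable_dB by (auto intro!: measurable_Ito_process measurable_discount)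
  obtain A where A: "finite A"
    "AE \<omega> in M. (discount m \<mu> \<sigma> r dB x k \<omega>, Ito_process m \<mu> \<sigma> dB x k \<omega>) \<in> A"
    using AE_finite_range by blast
  have "AE \<omega> in M. norm (discount m \<mu> \<sigma> r dB x k \<omega> * h (Ito_process m \<mu> \<sigma> dB x k \<omega>)) \<le>
      Max ((\<lambda>(d, y). norm (d * h y)) ` A)"
    using A(2)
  proof eventually_elim
    case (elim \<omega>)
    then have "norm (discount m \<mu> \<sigma> r dB x k \<omega> * h (Ito_process m \<mu> \<sigma> dB x k \<omega>)) \<in>
        (\<lambda>(d, y). norm (d * h y)) ` A"
      by (rule rev_image_eqI) simp
    with A(1) show ?case
      by (intro Max_ge finite_imageI)
  qed
  then show ?thesis
    by (rule integrable_const_bound) measurable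
qed

text \<open>Discount and state at time \<open>k\<close> depend only on steps 1 to \<open>k\<close>,
  so they are independent of step \<open>k + 1\<close>, which equals \<open>s\<close> with
  probability 1/2.\<close>

lemma expectation_last_step:
  assumes [measurable]: "h \<in> borel_measurable borel" and s: "s \<in> {dx m, - dx m}"
  shows "integrable M (\<lambda>\<omega>. indicator {s} (dB (Suc k) \<omega>) *
      (discount m \<mu> \<sigma> r dB x k \<omega> * h (Ito_process m \<mu> \<sigma> dB x k \<omega>)))" (is "integrable M ?f")
    and "expectation (\<lambda>\<omega>. indicator {s} (dB (Suc k) \<omega>) *
        (discount m \<mu> \<sigma> r dB x k \<omega> * h (Ito_process m \<mu> \<sigma> dB x k \<omega>))) =
      expectation (\<lambda>\<omega>. discount m \<mu> \<sigma> r dB x k \<omega> * h (Ito_process m \<mu> \<sigma> dB x k \<omega>)) / 2"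
proof -
  let ?Z = "\<lambda>\<omega>. discount m \<mu> \<sigma> r dB x k \<omega> * h (Ito_process m \<mu> \<sigma> dB x k \<omega>)"
  let ?I = "\<lambda>\<omega>. indicator {s} (dB (Suc k) \<omega>) :: real"
  \<comment> \<open>\<open>F\<close> is \<open>?Z\<close> as a function of the step vector, so that
    independence of the disjoint index blocks \<open>{Suc k}\<close> and \<open>{1..k}\<close>
    carries over to \<open>?I\<close> and \<open>?Z\<close>.\<close>
  define F where "F = (\<lambda>y. discount m \<mu> \<sigma> r (\<lambda>i y. y i) x k y *
    h (Ito_process m \<mu> \<sigma> (\<lambda>i y. y i) x k y))"
  have [measurable]: "dB (Suc k) \<in> borel_measurable M"
    by (simp add: measurable_dB)
  have [measurable]:
    "discount m \<mu> \<sigma> r (\<lambda>i y. y i) x k \<in> borel_measurable (\<Pi>\<^sub>M i\<in>{1..k}. borel)"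
    "Ito_process m \<mu> \<sigma> (\<lambda>i y. y i) x k \<in> borel_measurable (\<Pi>\<^sub>M i\<in>{1..k}. borel)"
    by (auto intro!: measurable_Ito_process measurable_discount measurable_component_singleton)
  have F: "F \<in> borel_measurable (\<Pi>\<^sub>M i\<in>{1..k}. borel)"
    unfolding F_def by measurable
  have "indep_var (\<Pi>\<^sub>M i\<in>{Suc k}. borel) (\<lambda>\<omega>. restrict (\<lambda>i. dB i \<omega>) {Suc k})
      (\<Pi>\<^sub>M i\<in>{1..k}. borel) (\<lambda>\<omega>. restrict (\<lambda>i. dB i \<omega>) {1..k})"
    by (rule indep_var_restrict[OF indep]) auto
  then have "indep_var borel ((\<lambda>y. indicator {s} (y (Suc k))) \<circ> (\<lambda>\<omega>. restrict (\<lambda>i. dB i \<omega>) {Suc k}))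
      borel (F \<circ> (\<lambda>\<omega>. restrict (\<lambda>i. dB i \<omega>) {1..k}))"
    by (rule indep_var_compose) (use F in measurable)
  moreover have "F \<circ> (\<lambda>\<omega>. restrict (\<lambda>i. dB i \<omega>) {1..k}) = ?Z"
    by (simp add: F_def fun_eq_iff Ito_process_restrict discount_restrict del: One_nat_def)
  ultimately have iv: "indep_var borel ?I borel ?Z"
    by (simp add: comp_def)
  have I: "integrable M ?I"
    by (rule integrable_const_bound[where B = 1]) (auto simp: indicator_def)
  have Z: "integrable M ?Z"
    by (rule integrable_discounted) measurable
  have "expectation ?I = expectation (indicator {\<omega> \<in> space M. dB (Suc k) \<omega> = s})"
    by (rule Bochner_Integration.integral_cong) (auto simp: indicator_def)
  also have "\<dots> = 1 / 2"
    using prob_dB[of "Suc k" s] s by simp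
  finally show "expectation (\<lambda>\<omega>. ?I \<omega> * ?Z \<omega>) = expectation ?Z / 2"
    using indep_var_lebesgue_integral[OF iv I Z] by simp
  show "integrable M ?f"
    using indep_var_integrable[OF iv I Z] .
qed

lemma expectation_discounted_Suc:
  assumes [measurable]: "h \<in> borel_measurable borel"
  shows "expectation (\<lambda>\<omega>. discount m \<mu> \<sigma> r dB x (Suc k) \<omega> * h (Ito_process m \<mu> \<sigma> dB x (Suc k) \<omega>)) =
    expectation (\<lambda>\<omega>. discount m \<mu> \<sigma> r dB x k \<omega> * fk_step m \<mu> \<sigma> r h (Ito_process m \<mu> \<sigma> dB x k \<omega>))"
proof -
  let ?D = "discount m \<mu> \<sigma> r dB x k" and ?S = "Ito_process m \<mu> \<sigma> dB x k"
  \<comment> \<open>The newest discount factor uses the state before the step, so it can be absorbed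
    into the payoff on each of the two branches.\<close>
  define hp where "hp = (\<lambda>y. exp (- r y * dt m) * h (x_plus m \<mu> \<sigma> y))"
  define hm where "hm = (\<lambda>y. exp (- r y * dt m) * h (x_minus m \<mu> \<sigma> y))"
  have hp: "hp \<in> borel_measurable borel" and hm: "hm \<in> borel_measurable borel"
    unfolding hp_def hm_def x_plus_def x_minus_def by measurable
  have [measurable]: "?S \<in> borel_measurable M" "?D \<in> borel_measurable M"
    "Ito_process m \<mu> \<sigma> dB x (Suc k) \<in> borel_measurable M"
    "discount m \<mu> \<sigma> r dB x (Suc k) \<in> borel_measurable M"
    "dB (Suc k) \<in> borel_measurable M" "hp \<in> borel_measurable borel" "hm \<in> borel_measurable borel"
    using measurable_dB hp hm
    by (auto intro!: measurable_Ito_process measurable_discount simp del: Ito_process.simps)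
  have "expectation (\<lambda>\<omega>. discount m \<mu> \<sigma> r dB x (Suc k) \<omega> * h (Ito_process m \<mu> \<sigma> dB x (Suc k) \<omega>)) =
      expectation (\<lambda>\<omega>. indicator {dx m} (dB (Suc k) \<omega>) * (?D \<omega> * hp (?S \<omega>)) +
        indicator {- dx m} (dB (Suc k) \<omega>) * (?D \<omega> * hm (?S \<omega>)))"
  proof (rule integral_cong_AE)
    show "AE \<omega> in M. discount m \<mu> \<sigma> r dB x (Suc k) \<omega> * h (Ito_process m \<mu> \<sigma> dB x (Suc k) \<omega>) =
        indicator {dx m} (dB (Suc k) \<omega>) * (?D \<omega> * hp (?S \<omega>)) +
        indicator {- dx m} (dB (Suc k) \<omega>) * (?D \<omega> * hm (?S \<omega>))"
      \<comment> \<open>As \<open>dx m > 0\<close>, the two values differ and exactly one indicator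
        is 1.\<close>
      using AE_dB[of "Suc k", simplified]
      by eventually_elim
        (use dx_pos[of m] in \<open>auto simp: discount_Suc hp_def hm_def x_plus_def x_minus_def\<close>)
  qed measurable
  also have "\<dots> = expectation (\<lambda>\<omega>. ?D \<omega> * hp (?S \<omega>)) / 2 + expectation (\<lambda>\<omega>. ?D \<omega> * hm (?S \<omega>)) / 2"
    using hp hm by (simp add: expectation_last_step)
  also have "\<dots> = expectation (\<lambda>\<omega>. (?D \<omega> * hp (?S \<omega>) + ?D \<omega> * hm (?S \<omega>)) / 2)"
    using integrable_discounted[OF hp] integrable_discounted[OF hm] by (simp add: add_divide_distrib)
  also have "(\<lambda>\<omega>. (?D \<omega> * hp (?S \<omega>) + ?D \<omega> * hm (?S \<omega>)) / 2) = (\<lambda>\<omega>. ?D \<omega> * fk_step m \<mu> \<sigma> r h (?S \<omega>))"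
    by (simp add: fun_eq_iff fk_step_def hp_def hm_def algebra_simps)
  finally show ?thesis .
qed

text \<open>Each use of \<open>expectation_discounted_Suc\<close> trades one time step for one
  application of \<open>fk_step\<close> to the payoff, hence the induction over all payoffs
  \<open>g\<close>.\<close>

lemma feynman_kac_eq_funpow:
  assumes "g \<in> borel_measurable borel"
  shows "feynman_kac M m dB \<mu> \<sigma> r g k = (fk_step m \<mu> \<sigma> r ^^ k) g"
proof -
  have "expectation (\<lambda>\<omega>. discount m \<mu> \<sigma> r dB x k \<omega> * g (Ito_process m \<mu> \<sigma> dB x k \<omega>)) =
      (fk_step m \<mu> \<sigma> r ^^ k) g x" for x
    using assms
  proof (induction k arbitrary: g)
    case 0
    then show ?case
      by (simp add: discount_0 prob_space)
  next
    case (Suc k)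
    then show ?case
      \<comment> \<open>The new \<open>fk_step\<close> acts innermost, on \<open>g\<close>, whereas
        \<open>funpow\<close> unfolds outermost; \<open>funpow_swap1\<close> reconciles
        them.\<close>
      by (simp add: expectation_discounted_Suc measurable_fk_step meas funpow_swap1
          del: Ito_process.simps)
  qed
  then show ?thesis
    by (simp add: fun_eq_iff feynman_kac_def discount_def)
qed

end

end

theorem lemma10:
  fixes M :: "'a measure" and dB :: "nat \<Rightarrow> 'a \<Rightarrow> real" and m :: nat
    and \<mu> \<sigma> r g :: "real \<Rightarrow> real" and \<mu>\<^sub>0 \<sigma>\<^sub>0 r\<^sub>0 :: real
  assumes "continuous_on UNIV \<mu>" and "continuous_on UNIV \<sigma>"
    and "continuous_on UNIV r" and "continuous_on UNIV g"
    and "\<forall>x. \<sigma> x \<ge> 0"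
    and "\<sigma>\<^sub>0 > 0" and "r\<^sub>0 > 0"
    and "ereal (real m) > m_threshold \<mu>\<^sub>0 \<sigma>\<^sub>0 r\<^sub>0"
    and "walk_steps M m dB"
  shows "solves_difference_equation m \<mu> \<sigma> r g (feynman_kac M m dB \<mu> \<sigma> r g) \<and>
    (\<forall>u. solves_difference_equation m \<mu> \<sigma> r g u \<longrightarrow> u = feynman_kac M m dB \<mu> \<sigma> r g)"
proof -
  interpret prob_space M
    using assms(9) by (simp add: walk_steps_def)
  interpret random_walk M m dB
    by unfold_locales (rule assms(9))
  \<comment> \<open>Continuity enters through Borel measurability. The functional is then the one
    solution singled out by \<open>solves_difference_equation_iff\<close>.\<close>
  have "feynman_kac M m dB \<mu> \<sigma> r g = (\<lambda>k. (fk_step m \<mu> \<sigma> r ^^ k) g)"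
    using assms(1-4) by (intro ext[of "feynman_kac M m dB \<mu> \<sigma> r g"] feynman_kac_eq_funpow
        borel_measurable_continuous_onI)
  then show ?thesis
    by (simp add: solves_difference_equation_iff)
qed

end
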